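(* Let $U$ be a uninorm, let $\circ$ be a binary operation on a set $M$, and let $E$ be a $U$-indistinguishability operator on $M$ that is regular with respect to $\circ$. Define $\tilde{\circ}:M\times M\times M\to[0,1]$ by $\tilde{\circ}(x,y,z)=E(x\circ y,z)$ for all $x,y,z\in M$. Then: (1) $\tilde{\circ}$ is a $U$-vague binary operation on $M$ (with respect to $E$). (2) If $(M,\circ)$ is a monoid, then $(M,\tilde{\circ})$ is a $U$-vague monoid.
   Context: A uninorm is a map $U:[0,1]^2\to[0,1]$ that is commutative, associative, non-decreasing in each argument, and has an identity element in $[0,1]$ (some $u$ with $U(x,u)=x$ for all $x$). By associativity, $U(a,b,c,d)$ denotes the iterated value $U(U(U(a,b),c),d)$. A $U$-indistinguishability operator on $M$ is a map $E:M\times M\to[0,1]$ with $E(x,x)=1$, $E(x,y)=E(y,x)$ and $U(E(x,y),E(y,z))\le E(x,z)$ for all $x,y,z\in M$. $E$ is regular with respect to $\circ$ if $E(x,y)\le E(x\circ z,y\circ z)$ and $E(x,y)\le E(z\circ x,z\circ y)$ for all $x,y,z\in M$. A $U$-vague binary operation on $M$ (with respect to $E$) is a map $\tilde{\circ}:M^3\to[0,1]$ such that for all $x,y,z,x',y',z'\in M$: (i) $U(\tilde{\circ}(x,y,z),E(x,x'),E(y,y'),E(z,z'))\le\tilde{\circ}(x',y',z')$; (ii) $U(\tilde{\circ}(x,y,z),\tilde{\circ}(x,y,z'))\le E(z,z')$; (iii) for all $x,y\in M$ there is $z\in M$ with $\tilde{\circ}(x,y,z)=1$. $(M,\tilde{\circ})$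 is a $U$-vague monoid if $\tilde{\circ}$ is a $U$-vague binary operation with respect to $E$, $U(\tilde{\circ}(y,z,d),\tilde{\circ}(x,d,m),\tilde{\circ}(x,y,q),\tilde{\circ}(q,z,w))\le E(m,w)$ for all $x,y,z,d,m,q,w\in M$, and there is $e\in M$ with $\tilde{\circ}(e,x,x)=1=\tilde{\circ}(x,e,x)$ for all $x\in M$. *)

theory Defs
  imports Complex_Main "HOL-Library.FuncSet" "HOL-Algebra.Group"
begin

text \<open>
  Maps on \<open>[0,1]\<close> and on a set \<open>M\<close> are total functions that are constrained only on
  \<open>{0..1}\<close> resp. \<open>M\<close>.
\<close>

definition uninorm :: "(real \<Rightarrow> real \<Rightarrow> real) \<Rightarrow> bool" where
  "uninorm U \<longleftrightarrow>
     U \<in> {0..1} \<rightarrow> {0..1} \<rightarrow> {0..1} \<and>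
     (\<forall>x\<in>{0..1}. \<forall>y\<in>{0..1}. U x y = U y x) \<and>
     (\<forall>x\<in>{0..1}. \<forall>y\<in>{0..1}. \<forall>z\<in>{0..1}. U (U x y) z = U x (U y z)) \<and>
     (\<forall>x\<in>{0..1}. \<forall>y\<in>{0..1}. \<forall>z\<in>{0..1}. x \<le> y \<longrightarrow> U x z \<le> U y z \<and> U z x \<le> U z y) \<and>
     (\<exists>u\<in>{0..1}. \<forall>x\<in>{0..1}. U x u = x)"

definition iter4 :: "('a \<Rightarrow> 'a \<Rightarrow> 'a) \<Rightarrow> 'a \<Rightarrow> 'a \<Rightarrow> 'a \<Rightarrow> 'a \<Rightarrow> 'a" where
  "iter4 U a b c d = U (U (U a b) c) d"

definition indistinguishability_operator ::
    "(real \<Rightarrow> real \<Rightarrow> real) \<Rightarrow> 'a set \<Rightarrow> ('a \<Rightarrow> 'a \<Rightarrow> real) \<Rightarrow> bool" where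
  "indistinguishability_operator U M E \<longleftrightarrow>
     E \<in> M \<rightarrow> M \<rightarrow> {0..1} \<and>
     (\<forall>x\<in>M. E x x = 1) \<and>
     (\<forall>x\<in>M. \<forall>y\<in>M. E x y = E y x) \<and>
     (\<forall>x\<in>M. \<forall>y\<in>M. \<forall>z\<in>M. U (E x y) (E y z) \<le> E x z)"

definition regular_wrt ::
    "'a set \<Rightarrow> ('a \<Rightarrow> 'a \<Rightarrow> real) \<Rightarrow> ('a \<Rightarrow> 'a \<Rightarrow> 'a) \<Rightarrow> bool" where
  "regular_wrt M E f \<longleftrightarrow>
     (\<forall>x\<in>M. \<forall>y\<in>M. \<forall>z\<in>M. E x y \<le> E (f x z) (f y z) \<and> E x y \<le> E (f z x) (f z y))"

definition vague_binary_operation ::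
    "(real \<Rightarrow> real \<Rightarrow> real) \<Rightarrow> 'a set \<Rightarrow> ('a \<Rightarrow> 'a \<Rightarrow> real) \<Rightarrow> ('a \<Rightarrow> 'a \<Rightarrow> 'a \<Rightarrow> real) \<Rightarrow> bool" where
  "vague_binary_operation U M E v \<longleftrightarrow>
     v \<in> M \<rightarrow> M \<rightarrow> M \<rightarrow> {0..1} \<and>
     (\<forall>x\<in>M. \<forall>y\<in>M. \<forall>z\<in>M. \<forall>x'\<in>M. \<forall>y'\<in>M. \<forall>z'\<in>M.
        iter4 U (v x y z) (E x x') (E y y') (E z z') \<le> v x' y' z') \<and>
     (\<forall>x\<in>M. \<forall>y\<in>M. \<forall>z\<in>M. \<forall>z'\<in>M. U (v x y z) (v x y z') \<le> E z z') \<and>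
     (\<forall>x\<in>M. \<forall>y\<in>M. \<exists>z\<in>M. v x y z = 1)"

definition vague_monoid ::
    "(real \<Rightarrow> real \<Rightarrow> real) \<Rightarrow> 'a set \<Rightarrow> ('a \<Rightarrow> 'a \<Rightarrow> real) \<Rightarrow> ('a \<Rightarrow> 'a \<Rightarrow> 'a \<Rightarrow> real) \<Rightarrow> bool" where
  "vague_monoid U M E v \<longleftrightarrow>
     vague_binary_operation U M E v \<and>
     (\<forall>x\<in>M. \<forall>y\<in>M. \<forall>z\<in>M. \<forall>d\<in>M. \<forall>m\<in>M. \<forall>q\<in>M. \<forall>w\<in>M.
        iter4 U (v y z d) (v x d m) (v x y q) (v q z w) \<le> E m w) \<and>
     (\<exists>e\<in>M. \<forall>x\<in>M. v e x x = 1 \<and> v x e x = 1)"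

end

theory Submission
  imports Defs
begin

text \<open>
  By monotonicity of \<open>U\<close>, transitivity chains: if \<open>a \<le> E x y\<close> and \<open>b \<le> E y z\<close> then
  \<open>U a b \<le> E x z\<close>. Regularity bounds each factor of an iterated value by an \<open>E\<close>-value between
  products, so that the factors link up into a path; for the monoid inequality the path runs
  \<open>m\<close>, \<open>x \<circ> d\<close>, \<open>x \<circ> (y \<circ> z) = (x \<circ> y) \<circ> z\<close>, \<open>q \<circ> z\<close>, \<open>w\<close>.
\<close>

lemma uninorm_closed:
  assumes "uninorm U" "a \<in> {0..1}" "b \<in> {0..1}"
  shows "U a b \<in> {0..1}"
  using assms unfolding uninorm_def Pi_iff by blast

lemma uninorm_mono:
  assumes "uninorm U" "a \<in> {0..1}" "b \<in> {0..1}" "c \<in> {0..1}" "d \<in> {0..1}" "a \<le> c" "b \<le> d"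
  shows "U a b \<le> U c d"
proof -
  have "U a b \<le> U c b" "U c b \<le> U c d"
    using assms unfolding uninorm_def by blast+
  then show ?thesis by (rule order_trans)
qed

lemma indistinguishability_closed:
  assumes "indistinguishability_operator U M E" "x \<in> M" "y \<in> M"
  shows "E x y \<in> {0..1}"
  using assms unfolding indistinguishability_operator_def Pi_iff by blast

lemma indistinguishability_refl:
  assumes "indistinguishability_operator U M E" "x \<in> M"
  shows "E x x = 1"
  using assms unfolding indistinguishability_operator_def by blast

lemma indistinguishability_sym:
  assumes "indistinguishability_operator U M E" "x \<in> M" "y \<in> M"
  shows "E x y = E y x"
  using assms unfolding indistinguishability_operator_def by blast

text \<open>The bounds \<open>a\<close> and \<open>b\<close> need not be values of \<open>E\<close>,
  so the result \<open>U a b\<close> can take the place of \<open>a\<close> in the next application.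
  Left-nested iterated values are thus bounded one factor at a time.\<close>

lemma indistinguishability_chain:
  assumes U: "uninorm U" and E: "indistinguishability_operator U M E"
    and M: "x \<in> M" "y \<in> M" "z \<in> M"
    and ab: "a \<in> {0..1}" "b \<in> {0..1}" "a \<le> E x y" "b \<le> E y z"
  shows "U a b \<le> E x z"
proof -
  have "U a b \<le> U (E x y) (E y z)"
    using uninorm_mono[OF U] ab indistinguishability_closed[OF E] M by blast
  also have "\<dots> \<le> E x z"
    using E M unfolding indistinguishability_operator_def by blast
  finally show ?thesis .
qed

lemma regular_left:
  assumes "regular_wrt M E f" "x \<in> M" "y \<in> M" "z \<in> M"
  shows "E x y \<le> E (f z x) (f z y)"
  using assms unfolding regular_wrt_def by blast

lemma regular_right:
  assumes "regular_wrt M E f" "x \<in> M" "y \<in> M" "z \<in> M"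
  shows "E x y \<le> E (f x z) (f y z)"
  using assms unfolding regular_wrt_def by blast

text \<open>Regularity lets one argument of \<open>f\<close> change at a time. The link between
  \<open>v\<close> and \<open>E\<close> is assumed pointwise on \<open>M\<close>, since values
  outside \<open>M\<close> are unconstrained.\<close>

lemma vague_binary_operation_of_regular:
  assumes U: "uninorm U" and f: "f \<in> M \<rightarrow> M \<rightarrow> M"
    and E: "indistinguishability_operator U M E" and reg: "regular_wrt M E f"
    and v: "\<And>x y z. x \<in> M \<Longrightarrow> y \<in> M \<Longrightarrow> z \<in> M \<Longrightarrow> v x y z = E (f x y) z"
  shows "vague_binary_operation U M E v"
  unfolding vague_binary_operation_def
proof (intro conjI ballI)
  have fM: "f x y \<in> M" if "x \<in> M" "y \<in> M" for x y
    using f that by blast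
  note EI = indistinguishability_closed[OF E]
  show "v \<in> M \<rightarrow> M \<rightarrow> M \<rightarrow> {0..1}"
    using EI fM v by (simp add: Pi_iff)
  show "iter4 U (v x y z) (E x x') (E y y') (E z z') \<le> v x' y' z'"
    if M: "x \<in> M" "y \<in> M" "z \<in> M" "x' \<in> M" "y' \<in> M" "z' \<in> M" for x y z x' y' z'
  proof -
    \<comment> \<open>The path is \<open>z\<close>, \<open>f x y\<close>, \<open>f x' y\<close>,
      \<open>f x' y'\<close>. It starts at \<open>z\<close> because the nesting of
      \<open>iter4\<close> absorbs \<open>E x x'\<close> and \<open>E y y'\<close>, which extend the
      other end, before \<open>E z z'\<close>.\<close>
    have "U (U (E (f x y) z) (E x x')) (E y y') \<le> E z (f x' y')"
    proof (rule indistinguishability_chain[OF U E])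
      show "U (E (f x y) z) (E x x') \<le> E z (f x' y)"
        using indistinguishability_chain[OF U E, of z "f x y" "f x' y"] M fM EI
          regular_right[OF reg] indistinguishability_sym[OF E] by simp
      show "E y y' \<le> E (f x' y) (f x' y')"
        using regular_left[OF reg] M by blast
    qed (use M fM EI uninorm_closed[OF U] in simp_all)
    \<comment> \<open>Symmetry turns the path around, so that \<open>E z z'\<close> can extend it
      beyond \<open>z\<close>.\<close>
    then have "U (U (E (f x y) z) (E x x')) (E y y') \<le> E (f x' y') z"
      using indistinguishability_sym[OF E, of z "f x' y'"] M fM by simp
    then have "U (U (U (E (f x y) z) (E x x')) (E y y')) (E z z') \<le> E (f x' y') z'"
      by (rule indistinguishability_chain[OF U E, rotated -2])
         (use M fM EI uninorm_closed[OF U] in simp_all)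
    then show ?thesis
      using M v unfolding iter4_def by simp
  qed
  \<comment> \<open>Both factors meet at \<open>f x y\<close>.\<close>
  show "U (v x y z) (v x y z') \<le> E z z'"
    if M: "x \<in> M" "y \<in> M" "z \<in> M" "z' \<in> M" for x y z z'
    using indistinguishability_chain[OF U E, of z "f x y" z'] M v fM EI
      indistinguishability_sym[OF E, of z "f x y"] by simp
  show "\<exists>z\<in>M. v x y z = 1" if "x \<in> M" "y \<in> M" for x y
    using that fM v indistinguishability_refl[OF E] by (intro bexI[of _ "f x y"]) simp_all
qed

theorem proposition4p10:
  fixes U :: "real \<Rightarrow> real \<Rightarrow> real"
    and M :: "'a set"
    and f :: "'a \<Rightarrow> 'a \<Rightarrow> 'a"
    and E :: "'a \<Rightarrow> 'a \<Rightarrow> real"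
    and v :: "'a \<Rightarrow> 'a \<Rightarrow> 'a \<Rightarrow> real"
  assumes "uninorm U"
    and "f \<in> M \<rightarrow> M \<rightarrow> M"
    and "indistinguishability_operator U M E"
    and "regular_wrt M E f"
    and "\<And>x y z. x \<in> M \<Longrightarrow> y \<in> M \<Longrightarrow> z \<in> M \<Longrightarrow> v x y z = E (f x y) z"
  shows "vague_binary_operation U M E v \<and>
    ((\<exists>e. monoid \<lparr>carrier = M, mult = f, one = e\<rparr>) \<longrightarrow> vague_monoid U M E v)"
proof (intro conjI impI)
  note U = assms(1) and E = assms(3) and reg = assms(4) and v = assms(5)
  show vbo: "vague_binary_operation U M E v"
    using assms by (rule vague_binary_operation_of_regular)
  have fM: "f x y \<in> M" if "x \<in> M" "y \<in> M" for x y
    using assms(2) that by blast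
  assume "\<exists>e. monoid \<lparr>carrier = M, mult = f, one = e\<rparr>"
  then obtain e where mon: "monoid \<lparr>carrier = M, mult = f, one = e\<rparr>" by blast
  have assoc: "f (f x y) z = f x (f y z)" if "x \<in> M" "y \<in> M" "z \<in> M" for x y z
    using monoid.m_assoc[OF mon] that by simp
  have e: "e \<in> M" "\<And>x. x \<in> M \<Longrightarrow> f e x = x" "\<And>x. x \<in> M \<Longrightarrow> f x e = x"
    using monoid.one_closed[OF mon] monoid.l_one[OF mon] monoid.r_one[OF mon] by simp_all
  show "vague_monoid U M E v"
    unfolding vague_monoid_def
  proof (intro conjI ballI)
    show "iter4 U (v y z d) (v x d m) (v x y q) (v q z w) \<le> E m w"
      if M: "x \<in> M" "y \<in> M" "z \<in> M" "d \<in> M" "m \<in> M" "q \<in> M" "w \<in> M" for x y z d m q w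
    proof -
      note EI = indistinguishability_closed[OF E]
      \<comment> \<open>The first two factors join \<open>?p\<close> to \<open>m\<close>, the last
        two join it to \<open>w\<close>.\<close>
      let ?p = "f x (f y z)"
      have "E (f y z) d \<le> E ?p (f x d)"
        using regular_left[OF reg] M fM by blast
      then have "U (E (f y z) d) (E (f x d) m) \<le> E ?p m"
        using M fM EI by (intro indistinguishability_chain[OF U E, of _ "f x d"]) simp_all
      \<comment> \<open>The path is reversed to end at \<open>?p\<close>, where the third factor
        continues it.\<close>
      then have 1: "U (E (f y z) d) (E (f x d) m) \<le> E m ?p"
        using indistinguishability_sym[OF E, of m ?p] M fM by simp
      \<comment> \<open>Associativity enters here: regularity yields \<open>f (f x y) z\<close>,
        which equals \<open>?p\<close>.\<close>
      have "E (f x y) q \<le> E ?p (f q z)"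
        using regular_right[OF reg, of "f x y" q z] assoc M fM by simp
      with 1 have "U (U (E (f y z) d) (E (f x d) m)) (E (f x y) q) \<le> E m (f q z)"
        by (rule indistinguishability_chain[OF U E, rotated -2])
           (use M fM EI uninorm_closed[OF U] in simp_all)
      then have "iter4 U (E (f y z) d) (E (f x d) m) (E (f x y) q) (E (f q z) w) \<le> E m w"
        unfolding iter4_def
        by (rule indistinguishability_chain[OF U E, rotated -2])
           (use M fM EI uninorm_closed[OF U] in simp_all)
      then show ?thesis
        using M v by simp
    qed
    \<comment> \<open>The identity of the monoid serves, since both values reduce to
      \<open>E x x\<close>.\<close>
    show "\<exists>e\<in>M. \<forall>x\<in>M. v e x x = 1 \<and> v x e x = 1"
      using e v indistinguishability_refl[OF E] by (intro bexI[of _ e]) simp_all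
  qed (rule vbo)
qed

end
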